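(* Let $\rho$ be a size function on a set $E$, and let $\rho^{\circ} : 2^E \to \overline{\mathbb{R}}_+$ be its monk. Then the following properties hold: (1) $\rho^{\circ}(A) \leqslant \rho(A)$, for all subsets $A$ of $E$; (2) $\rho^{\circ}(\{x\}) = \rho(\{x\})$, for all $x \in E$; (3) $\rho^{\circ}(A \cup A') = \max(\rho^{\circ}(A), \rho^{\circ}(A'))$, for all subsets $A, A'$ of $E$; (4) $(\rho^{\circ})^{\circ}(A) = \rho^{\circ}(A)$, for all subsets $A$ of $E$. In particular, $\rho^{\circ}$ is a size function, and it is total if $\rho$ is total.
   Context: $\overline{\mathbb{R}}_+ = \mathbb{R}_+ \cup \{\infty\}$, where $\mathbb{R}_+$ is the set of nonnegative real numbers. A size function on a set $E$ is a map $\rho : 2^E \to \overline{\mathbb{R}}_+$ such that $\rho(\emptyset) = 0$; $\rho(\{x\}) < \infty$ for all $x \in E$; and $\rho(A) \leqslant \rho(A')$ for all subsets $A \subseteq A'$ of $E$. The number $\rho(A)$ is called the size of $A$. The size function $\rho$ is total if $\rho(\{x\}) = 0$ for all $x \in E$. The monk of a size function $\rho$ is the map $\rho^{\circ}$ on $2^E$ defined by $\rho^{\circ}(A) = \inf\{ t > 0 : A \text{ is covered by finitely many subsets of } E \text{ of size } \leqslant t \}$, where $t$ ranges over positive reals and $\inf \emptyset = \infty$. In (4), $(\rho^{\circ})^{\circ}$ is obtained by applying the same formula with $\rho^{\circ}$ in place of $\rho$. *)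

theory Defs
  imports "HOL-Library.Extended_Nonnegative_Real"
begin

text \<open>A map on the power set of \<open>E\<close> is represented by a total function on \<open>'a set\<close>;
  only its values at subsets of \<open>E\<close> are relevant.\<close>

definition size_function :: "'a set \<Rightarrow> ('a set \<Rightarrow> ennreal) \<Rightarrow> bool" where
  "size_function E \<rho> \<longleftrightarrow>
     \<rho> {} = 0 \<and>
     (\<forall>x\<in>E. \<rho> {x} < \<infinity>) \<and>
     (\<forall>A A'. A \<subseteq> A' \<and> A' \<subseteq> E \<longrightarrow> \<rho> A \<le> \<rho> A')"

definition total_size_function :: "'a set \<Rightarrow> ('a set \<Rightarrow> ennreal) \<Rightarrow> bool" where
  "total_size_function E \<rho> \<longleftrightarrow> size_function E \<rho> \<and> (\<forall>x\<in>E. \<rho> {x} = 0)"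

text \<open>The infimum is taken in \<open>ennreal\<close>, where \<open>Inf {} = \<infinity>\<close>.\<close>

definition monk :: "'a set \<Rightarrow> ('a set \<Rightarrow> ennreal) \<Rightarrow> 'a set \<Rightarrow> ennreal" where
  "monk E \<rho> A =
     Inf {ennreal t | t::real. 0 < t \<and>
       (\<exists>\<C>. finite \<C> \<and> \<C> \<subseteq> Pow E \<and> A \<subseteq> \<Union>\<C> \<and> (\<forall>B\<in>\<C>. \<rho> B \<le> ennreal t))}"

end

theory Submission
  imports Defs
begin

text \<open>
  Fix a bound \<open>s\<close> and ask which sets are covered by finitely many subsets of \<open>E\<close> of size at most
  \<open>s\<close>. For each \<open>s\<close> these sets form an ideal: they are closed under subsets, under binary unions,
  and under finite covers by sets of the same kind. The monk records at which bound a set enters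
  the ideal: \<open>A\<close> is coverable at every bound strictly above its monk
  (\<open>coverable_if_monk_less\<close>), and the monk is at most every bound at which \<open>A\<close> is coverable
  (\<open>monk_le_if_coverable\<close>). Hence the closure properties of the ideals turn into properties of the
  monk. Since the infimum need not be attained, \<open>A\<close> may fail to be coverable at its monk
  itself; an inequality \<open>y \<le> z\<close> in which \<open>z\<close> is built from monks is therefore derived from
  \<open>y \<le> s\<close> for all \<open>s > z\<close>.

  Covering \<open>A\<close> by itself gives (1). A cover of a singleton \<open>{x}\<close> has a member that
  contains \<open>x\<close>, whose size is at least that of \<open>{x}\<close>, which gives (2). Closure under binary unions
  gives (3), and closure under finite covers gives (4): if finitely many sets of monk below \<open>s\<close>
  cover \<open>A\<close>, then finite covers of each of them at bound \<open>s\<close> together form a finite cover of \<open>A\<close>.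
\<close>

text \<open>The bound is an extended real, possibly \<open>0\<close> or \<open>\<infinity>\<close>, rather than a positive real as in the
  definition of the monk: then \<open>\<rho> A\<close> itself is an admissible bound for \<open>A\<close>, and the bound \<open>0\<close>
  is admissible for \<open>{}\<close>.\<close>

definition coverable :: "'a set \<Rightarrow> ('a set \<Rightarrow> ennreal) \<Rightarrow> ennreal \<Rightarrow> 'a set \<Rightarrow> bool" where
  "coverable E \<rho> s A \<longleftrightarrow>
     (\<exists>\<C>. finite \<C> \<and> \<C> \<subseteq> Pow E \<and> A \<subseteq> \<Union>\<C> \<and> (\<forall>B\<in>\<C>. \<rho> B \<le> s))"

lemma monk_eq_Inf_coverable:
  "monk E \<rho> A = Inf {ennreal t | t. 0 < t \<and> coverable E \<rho> (ennreal t) A}"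
  unfolding monk_def coverable_def ..

lemma coverable_mono:
  assumes "coverable E \<rho> s A'" "A \<subseteq> A'" "s \<le> s'"
  shows "coverable E \<rho> s' A"
proof -
  obtain \<C> where "finite \<C>" "\<C> \<subseteq> Pow E" "A' \<subseteq> \<Union>\<C>" "\<forall>B\<in>\<C>. \<rho> B \<le> s"
    using assms(1) unfolding coverable_def by blast
  then show ?thesis
    using assms(2,3) unfolding coverable_def by (intro exI[of _ \<C>]) auto
qed

lemma coverable_empty: "coverable E \<rho> s {}"
  unfolding coverable_def by (rule exI[of _ "{}"]) simp

lemma coverable_self: "A \<subseteq> E \<Longrightarrow> coverable E \<rho> (\<rho> A) A"
  unfolding coverable_def by (rule exI[of _ "{A}"]) simp

lemma coverable_Un:
  assumes "coverable E \<rho> s A" "coverable E \<rho> s A'"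
  shows "coverable E \<rho> s (A \<union> A')"
proof -
  obtain \<C> where "finite \<C>" "\<C> \<subseteq> Pow E" "A \<subseteq> \<Union>\<C>" "\<forall>B\<in>\<C>. \<rho> B \<le> s"
    using assms(1) unfolding coverable_def by blast
  moreover obtain \<D> where "finite \<D>" "\<D> \<subseteq> Pow E" "A' \<subseteq> \<Union>\<D>" "\<forall>B\<in>\<D>. \<rho> B \<le> s"
    using assms(2) unfolding coverable_def by blast
  ultimately show ?thesis
    unfolding coverable_def by (intro exI[of _ "\<C> \<union> \<D>"]) auto
qed

lemma coverable_Union:
  assumes "finite \<C>" "\<And>B. B \<in> \<C> \<Longrightarrow> coverable E \<rho> s B"
  shows "coverable E \<rho> s (\<Union>\<C>)"
  using assms by (induction \<C>) (simp_all add: coverable_empty coverable_Un)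

text \<open>The bounds \<open>0\<close> and \<open>\<infinity>\<close> do not occur in the infimum that defines the monk. Every
  \<open>x > s\<close> is either \<open>\<infinity>\<close>, where nothing is to be shown, or a positive real, which does
  occur there; so it is enough to bound the monk by all such \<open>x\<close>.\<close>

lemma monk_le_if_coverable:
  assumes "coverable E \<rho> s A"
  shows "monk E \<rho> A \<le> s"
proof (rule dense_ge)
  fix x assume "s < x"
  show "monk E \<rho> A \<le> x"
  proof (cases x)
    case (real t)
    have "0 < x" using \<open>s < x\<close> by (rule le_less_trans[OF zero_le])
    then have "0 < t" using real by simp
    moreover have "coverable E \<rho> (ennreal t) A"
      using coverable_mono[OF assms order_refl] \<open>s < x\<close> real by simp
    ultimately show ?thesis
      unfolding monk_eq_Inf_coverable real by (intro Inf_lower) auto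
  qed simp
qed

lemma coverable_if_monk_less:
  assumes "monk E \<rho> A < s"
  shows "coverable E \<rho> s A"
proof -
  obtain t where "coverable E \<rho> (ennreal t) A" "ennreal t < s"
    using assms unfolding monk_eq_Inf_coverable Inf_less_iff by auto
  then show ?thesis by (rule coverable_mono[OF _ order_refl less_imp_le])
qed

lemma monk_empty: "monk E \<rho> {} = 0"
  using monk_le_if_coverable[OF coverable_empty, of E \<rho> 0] by simp

lemma monk_mono:
  assumes "A \<subseteq> A'"
  shows "monk E \<rho> A \<le> monk E \<rho> A'"
proof (rule dense_ge)
  fix s assume "monk E \<rho> A' < s"
  from coverable_mono[OF coverable_if_monk_less[OF this] assms order_refl]
  show "monk E \<rho> A \<le> s" by (rule monk_le_if_coverable)
qed

lemma monk_le: "A \<subseteq> E \<Longrightarrow> monk E \<rho> A \<le> \<rho> A"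
  by (intro monk_le_if_coverable coverable_self)

lemma monk_singleton:
  assumes "size_function E \<rho>" "x \<in> E"
  shows "monk E \<rho> {x} = \<rho> {x}"
proof (rule antisym)
  show "monk E \<rho> {x} \<le> \<rho> {x}" using assms(2) by (simp add: monk_le)
  show "\<rho> {x} \<le> monk E \<rho> {x}"
  proof (rule dense_ge)
    fix s assume "monk E \<rho> {x} < s"
    then have "coverable E \<rho> s {x}" by (rule coverable_if_monk_less)
    then obtain B where "x \<in> B" "B \<subseteq> E" "\<rho> B \<le> s"
      unfolding coverable_def by auto
    moreover have "\<rho> {x} \<le> \<rho> B"
      using assms(1) \<open>x \<in> B\<close> \<open>B \<subseteq> E\<close> unfolding size_function_def by simp
    ultimately show "\<rho> {x} \<le> s" by simp
  qed
qed

lemma monk_Un: "monk E \<rho> (A \<union> A') = max (monk E \<rho> A) (monk E \<rho> A')"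
proof (rule antisym)
  show "monk E \<rho> (A \<union> A') \<le> max (monk E \<rho> A) (monk E \<rho> A')"
  proof (rule dense_ge)
    fix s assume "max (monk E \<rho> A) (monk E \<rho> A') < s"
    then have "coverable E \<rho> s A" "coverable E \<rho> s A'"
      by (simp_all add: coverable_if_monk_less)
    then show "monk E \<rho> (A \<union> A') \<le> s"
      by (intro monk_le_if_coverable coverable_Un)
  qed
  show "max (monk E \<rho> A) (monk E \<rho> A') \<le> monk E \<rho> (A \<union> A')"
    by (simp add: monk_mono)
qed

lemma monk_monk:
  assumes "A \<subseteq> E"
  shows "monk E (monk E \<rho>) A = monk E \<rho> A"
proof (rule antisym)
  show "monk E (monk E \<rho>) A \<le> monk E \<rho> A" using assms by (rule monk_le)
  show "monk E \<rho> A \<le> monk E (monk E \<rho>) A"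
  proof (rule dense_ge)
    fix s assume "monk E (monk E \<rho>) A < s"
    \<comment> \<open>The intermediate bound makes the monks of the covering sets strictly less than \<open>s\<close>,
      so that these sets are themselves coverable at \<open>s\<close>.\<close>
    then obtain r where "monk E (monk E \<rho>) A < r" "r < s" using dense by blast
    then have "coverable E (monk E \<rho>) r A" by (intro coverable_if_monk_less)
    then obtain \<C> where \<C>: "finite \<C>" "A \<subseteq> \<Union>\<C>" "\<forall>B\<in>\<C>. monk E \<rho> B \<le> r"
      unfolding coverable_def by auto
    have "coverable E \<rho> s B" if "B \<in> \<C>" for B
      using le_less_trans[OF bspec[OF \<C>(3) that] \<open>r < s\<close>] by (rule coverable_if_monk_less)
    with \<C>(1) have "coverable E \<rho> s (\<Union>\<C>)" by (rule coverable_Union)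
    from coverable_mono[OF this \<C>(2) order_refl]
    show "monk E \<rho> A \<le> s" by (rule monk_le_if_coverable)
  qed
qed

lemma size_function_monk:
  assumes "size_function E \<rho>"
  shows "size_function E (monk E \<rho>)"
  using assms monk_singleton[OF assms]
  unfolding size_function_def[of E "monk E \<rho>"]
  by (auto simp: monk_empty size_function_def intro: monk_mono)

theorem proposition2p2:
  fixes E :: "'a set" and \<rho> :: "'a set \<Rightarrow> ennreal"
  assumes "size_function E \<rho>"
  shows "(\<forall>A. A \<subseteq> E \<longrightarrow> monk E \<rho> A \<le> \<rho> A) \<and>
         (\<forall>x\<in>E. monk E \<rho> {x} = \<rho> {x}) \<and>
         (\<forall>A A'. A \<subseteq> E \<and> A' \<subseteq> E \<longrightarrow>
            monk E \<rho> (A \<union> A') = max (monk E \<rho> A) (monk E \<rho> A')) \<and>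
         (\<forall>A. A \<subseteq> E \<longrightarrow> monk E (monk E \<rho>) A = monk E \<rho> A) \<and>
         size_function E (monk E \<rho>) \<and>
         (total_size_function E \<rho> \<longrightarrow> total_size_function E (monk E \<rho>))"
  using size_function_monk[OF assms]
  by (simp add: monk_le monk_singleton[OF assms] monk_Un monk_monk total_size_function_def)

end
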